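(* The numbers $a_t^E(P_n)$ of time-dependent assembly trees satisfying the edge gluing rule for the path graphs $P_n$ satisfy $a^E_t(P_1)=a^E_t(P_2)=1$ and, for every integer $n\ge 3$, $$a^E_t(P_n)=\sum_{j=1}^{\lfloor n/2\rfloor}\binom{n-j}{n-2j}a^E_t(P_{n-j}).$$
   Context: All graphs are finite and simple. Let $G=(V,E)$ be a connected graph with $|V|=N\ge 2$. A time-dependent assembly tree for $G$ is a rooted (unordered) tree each of whose nodes is labeled by a pair $(U,i)$ with $U\subseteq V$ and $i$ a nonnegative integer, such that: (1) the leaves are exactly $N$ in number, labeled $(v,0)$, one for each vertex $v\in V$ ($v$ identified with $\{v\}$); (2) each internal (non-leaf) node has at least two children; (3) the root is labeled $(V,m)$ for some $1\le m\le N-1$; (4) for each internal node $(U,i)$, $U$ is the union of the vertex sets labeling its children (equivalently, the set of leaves below it); (5) if $(U,i)$ and $(U',i')$ are adjacent nodes with $U\subseteq U'$, then $i<i'$; (6) for each $0\le i\le m$ there exists a node labeled $(U,i)$ for some $U\subseteq V$. For $N=1$, by convention the only time-dependent assembly tree is the single node $(v,0)$. Two such trees are the same if there is a label-preserving isomorphism of rooted trees between them. Such a tree satisfies the edge gluing rule if each internal node has exactly two children, with vertex sets $U_1$ and $U_2$ say, and there is an edge $v_1v_2\in E$ with $v_1\in U_1$ and $v_2\in U_2$. $a_t^E(G)$ is the number of time-dependent assembly trees for $G$ satisfying the edge gluing rule. $P_n$ is the path graph with vertices $1,\dots,n$ and edges $\{i,i+1\}$, $1\le i\le n-1$. *)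

theory Defs
  imports "HOL-Library.Multiset"
begin

text \<open>A graph is a pair of its vertex set and its set of edges \<open>{u, v}\<close>.\<close>

type_synonym 'v graph = "'v set \<times> 'v set set"

definition connected_simple_graph :: "'v graph \<Rightarrow> bool" where
  "connected_simple_graph G \<longleftrightarrow>
     finite (fst G) \<and> fst G \<noteq> {} \<and>
     (\<forall>e\<in>snd G. \<exists>u\<in>fst G. \<exists>v\<in>fst G. u \<noteq> v \<and> e = {u, v}) \<and>
     (\<forall>u\<in>fst G. \<forall>v\<in>fst G. (u, v) \<in> {(x, y). {x, y} \<in> snd G}\<^sup>*)"

definition path_graph :: "nat \<Rightarrow> nat graph" where
  "path_graph n = ({1..n}, {{i, i + 1} | i. 1 \<le> i \<and> i \<le> n - 1})"

text \<open>The notions below are intended for connected simple graphs only; path graphs qualify.\<close>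

lemma connected_simple_graph_path_graph:
  assumes "n \<ge> 1"
  shows "connected_simple_graph (path_graph n)"
proof -
  let ?R = "{(x, y). {x, y} \<in> snd (path_graph n)}"
  have sym: "sym ?R"
    by (auto simp: sym_def insert_commute)
  have from1: "(1, v) \<in> ?R\<^sup>*" if "1 \<le> v" "v \<le> n" for v
    using that
  proof (induction v rule: dec_induct)
    case base
    show ?case by simp
  next
    case (step v)
    have "(v, Suc v) \<in> ?R"
      using step by (auto simp: path_graph_def)
    moreover have "(1, v) \<in> ?R\<^sup>*"
      using step by simp
    ultimately show ?case
      by (rule rtrancl_into_rtrancl[rotated])
  qed
  have "(u, v) \<in> ?R\<^sup>*" if "u \<in> {1..n}" "v \<in> {1..n}" for u v
  proof -
    have "(u, 1) \<in> ?R\<^sup>*"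
      using from1[of u] that(1) sym_rtrancl[OF sym] by (auto dest: symD)
    moreover have "(1, v) \<in> ?R\<^sup>*"
      using from1[of v] that(2) by simp
    ultimately show ?thesis
      by (rule rtrancl_trans)
  qed
  moreover have "fst (path_graph n) = {1..n}"
    by (simp add: path_graph_def)
  moreover have "\<exists>u\<in>{1..n}. \<exists>v\<in>{1..n}. u \<noteq> v \<and> e = {u, v}" if e: "e \<in> snd (path_graph n)" for e
  proof -
    obtain i where "e = {i, i + 1}" "1 \<le> i" "i \<le> n - 1"
      using e unfolding path_graph_def snd_conv by blast
    then show ?thesis
      using assms by (intro bexI[of _ i] bexI[of _ "i + 1"]) auto
  qed
  ultimately show ?thesis
    using assms unfolding connected_simple_graph_def by auto
qed

text \<open>
  Rooted unordered trees whose nodes are labelled by pairs \<open>(U, i)\<close>. As the children of a node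
  form a multiset, two such trees are equal iff there is a label-preserving isomorphism of rooted
  trees between them, so counting elements of this type counts trees up to isomorphism.
\<close>

datatype 'v ltree = Node (label: "'v set \<times> nat") (children: "'v ltree multiset")

abbreviation vset :: "'v ltree \<Rightarrow> 'v set" where
  "vset t \<equiv> fst (label t)"

abbreviation time :: "'v ltree \<Rightarrow> nat" where
  "time t \<equiv> snd (label t)"

text \<open>
  A node is represented by the subtree rooted at it. This identifies distinct nodes with equal
  subtrees, so it is used only to quantify over nodes; the leaves are counted with multiplicity
  by \<open>leaf_labels\<close>.
\<close>

primrec nodes :: "'v ltree \<Rightarrow> 'v ltree set" where
  "nodes (Node l ts) = insert (Node l ts) (\<Union> (set_mset (image_mset nodes ts)))"

primrec leaf_labels :: "'v ltree \<Rightarrow> ('v set \<times> nat) multiset" where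
  "leaf_labels (Node l ts) =
     (if ts = {#} then {#l#} else sum_mset (image_mset leaf_labels ts))"

definition adjacent_nodes :: "'v ltree \<Rightarrow> 'v ltree \<Rightarrow> 'v ltree \<Rightarrow> bool" where
  "adjacent_nodes t s s' \<longleftrightarrow>
     s \<in> nodes t \<and> s' \<in> nodes t \<and> (s' \<in># children s \<or> s \<in># children s')"

definition time_dependent_assembly_tree :: "'v graph \<Rightarrow> 'v ltree \<Rightarrow> bool" where
  "time_dependent_assembly_tree G t \<longleftrightarrow>
     (if card (fst G) = 1 then (\<exists>v. fst G = {v} \<and> t = Node ({v}, 0) {#})
      else
        (\<forall>s\<in>nodes t. vset s \<subseteq> fst G) \<and>
        leaf_labels t = image_mset (\<lambda>v. ({v}, 0)) (mset_set (fst G)) \<and>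
        (\<forall>s\<in>nodes t. children s \<noteq> {#} \<longrightarrow> size (children s) \<ge> 2) \<and>
        (\<forall>s\<in>nodes t. children s \<noteq> {#} \<longrightarrow> vset s = (\<Union>c\<in>set_mset (children s). vset c)) \<and>
        (\<forall>s s'. adjacent_nodes t s s' \<and> vset s \<subseteq> vset s' \<longrightarrow> time s < time s') \<and>
        (\<exists>m. 1 \<le> m \<and> m \<le> card (fst G) - 1 \<and> label t = (fst G, m) \<and>
             (\<forall>i\<le>m. \<exists>s\<in>nodes t. time s = i)))"

definition edge_gluing_rule :: "'v graph \<Rightarrow> 'v ltree \<Rightarrow> bool" where
  "edge_gluing_rule G t \<longleftrightarrow>
     (\<forall>s\<in>nodes t. children s \<noteq> {#} \<longrightarrow>
        (\<exists>c1 c2. children s = {#c1, c2#} \<and>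
           (\<exists>v1\<in>vset c1. \<exists>v2\<in>vset c2. {v1, v2} \<in> snd G)))"

definition a_t_E :: "'v graph \<Rightarrow> nat" where
  "a_t_E G = card {t. time_dependent_assembly_tree G t \<and> edge_gluing_rule G t}"

end

theory Submission
  imports Defs
begin

text \<open>
  In an edge-glued assembly tree of a path every node carries an interval, and the two children of
  an internal node carry two consecutive intervals. Ordering the children from left to right
  therefore loses nothing and makes the vertex sets redundant: the tree is determined by an ordered
  binary tree with \<open>n\<close> leaves and a time at each internal node. The map \<open>assembly\<close> restores the
  vertex sets, and \<open>a_t_E_path_graph\<close> states that it is a bijection, so that \<open>a_t_E (path_graph n)\<close>
  counts the set \<open>timed_trees n\<close> of ordered trees whose times increase towards the root and fill an
  initial segment of the positive integers.

  For the recurrence, look at what happens at time 1. The nodes of time 1 join two leaves each, so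
  they form a matching of \<open>j \<ge> 1\<close> edges of the path. Contracting these edges (\<open>collapse\<close>) and
  setting the clock back by one yields a timed tree with \<open>n - j\<close> leaves. Conversely, such a tree
  together with the choice of the \<open>j\<close> leaves that came from contracted edges (\<open>marks\<close>)
  determines the original tree (\<open>expand\<close>). There are \<open>(n - j) choose j\<close> choices, and a choice
  exists iff \<open>j \<le> n - j\<close>, that is \<open>j \<le> n div 2\<close>. This bijection is \<open>bij_betw_first_step\<close>.
\<close>

section \<open>Ordered binary trees carrying times\<close>

datatype btree = Lf | Br nat btree btree

primrec width :: "btree \<Rightarrow> nat" where
  "width Lf = 1"
| "width (Br i l r) = width l + width r"

primrec root_time :: "btree \<Rightarrow> nat" where
  "root_time Lf = 0"
| "root_time (Br i l r) = i"

primrec times :: "btree \<Rightarrow> nat set" where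
  "times Lf = {}"
| "times (Br i l r) = insert i (times l \<union> times r)"

primrec increasing :: "btree \<Rightarrow> bool" where
  "increasing Lf \<longleftrightarrow> True"
| "increasing (Br i l r) \<longleftrightarrow> root_time l < i \<and> root_time r < i \<and> increasing l \<and> increasing r"

text \<open>
  The last condition says that no time between 0 and the time of the root is skipped.
\<close>

definition timed_trees :: "nat \<Rightarrow> btree set" where
  "timed_trees n = {x. width x = n \<and> increasing x \<and> times x = {1..root_time x}}"

lemma width_pos [simp]: "0 < width x"
  by (induction x) auto

lemma times_subset: "increasing x \<Longrightarrow> times x \<subseteq> {1..root_time x}"
proof (induction x)
  case (Br i l r)
  then show ?case by fastforce
qed simp

lemma finite_times [simp]: "finite (times x)"
  by (induction x) auto

text \<open>
  A binary tree has one internal node less than leaves, so the bound \<open>m \<le> N - 1\<close> on the root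
  time of an assembly tree is automatic once no time is skipped.
\<close>

lemma card_times_less_width: "card (times x) < width x"
proof (induction x)
  case (Br i l r)
  have "card (times (Br i l r)) \<le> Suc (card (times l \<union> times r))"
    by (simp add: card_insert_if)
  also have "\<dots> \<le> Suc (card (times l) + card (times r))"
    by (simp add: card_Un_le)
  finally show ?case using Br by simp
qed simp

lemma root_time_less_width: "x \<in> timed_trees n \<Longrightarrow> root_time x < n"
  using card_times_less_width[of x] by (auto simp: timed_trees_def)

section \<open>Removing and restoring the first gluing step\<close>

text \<open>
  A node of time 1 in an increasing tree has two leaves as children, so \<open>collapse\<close> may discard both
  subtrees there. The function \<open>marks\<close> lists the leaves of the collapsed tree from left to right and
  records which of them replace such a node.
\<close>

primrec collapse :: "btree \<Rightarrow> btree" where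
  "collapse Lf = Lf"
| "collapse (Br i l r) = (if i = 1 then Lf else Br (i - 1) (collapse l) (collapse r))"

primrec marks :: "btree \<Rightarrow> bool list" where
  "marks Lf = [False]"
| "marks (Br i l r) = (if i = 1 then [True] else marks l @ marks r)"

primrec expand :: "btree \<Rightarrow> bool list \<Rightarrow> btree" where
  "expand Lf bs = (if hd bs then Br 1 Lf Lf else Lf)"
| "expand (Br i l r) bs =
     Br (Suc i) (expand l (take (width l) bs)) (expand r (drop (width l) bs))"

definition markings :: "nat \<Rightarrow> nat \<Rightarrow> bool list set" where
  "markings k j = {bs. length bs = k \<and> count_list bs True = j}"

lemma increasing_root_time_0: "increasing x \<Longrightarrow> root_time x = 0 \<longleftrightarrow> x = Lf"
  by (cases x) auto

lemma length_marks: "increasing x \<Longrightarrow> length (marks x) = width (collapse x)"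
  by (induction x) auto

lemma width_collapse: "increasing x \<Longrightarrow> width (collapse x) + count_list (marks x) True = width x"
  by (induction x) (auto simp: increasing_root_time_0)

lemma expand_collapse: "increasing x \<Longrightarrow> expand (collapse x) (marks x) = x"
  by (induction x) (auto simp: increasing_root_time_0 length_marks)

lemma root_time_collapse: "increasing x \<Longrightarrow> root_time (collapse x) = root_time x - 1"
  by (cases x) auto

lemma increasing_collapse: "increasing x \<Longrightarrow> increasing (collapse x)"
  by (induction x) (auto simp: root_time_collapse)

text \<open>
  Below a node of time 1 there are no further times, so discarding its subtrees loses only the
  time 1 itself.
\<close>

lemma times_collapse: "increasing x \<Longrightarrow> Suc ` times (collapse x) = times x - {1}"
proof (induction x)
  case (Br i l r)
  show ?case
  proof (cases "i = 1")
    case True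
    then have "l = Lf" "r = Lf" using Br.prems increasing_root_time_0 by auto
    then show ?thesis using True by simp
  next
    case False
    then show ?thesis using Br by (auto simp: image_Un)
  qed
qed simp

lemma True_in_marks: "increasing x \<Longrightarrow> True \<in> set (marks x) \<longleftrightarrow> 1 \<in> times x"
  by (induction x) auto

lemma collapse_in_timed_trees:
  assumes "x \<in> timed_trees n"
  shows "collapse x \<in> timed_trees (n - count_list (marks x) True)"
proof -
  have inc: "increasing x" and w: "width x = n" and t: "times x = {1..root_time x}"
    using assms by (auto simp: timed_trees_def)
  have "Suc ` times (collapse x) = Suc ` {1..root_time x - 1}"
    using times_collapse[OF inc] t by (auto simp: image_Suc_atLeastAtMost)
  then have "times (collapse x) = {1..root_time x - 1}"
    by (simp only: inj_image_eq_iff[OF inj_Suc])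
  then have "times (collapse x) = {1..root_time (collapse x)}"
    by (simp only: root_time_collapse[OF inc])
  then show ?thesis
    using inc w width_collapse[OF inc] increasing_collapse[OF inc]
    by (auto simp: timed_trees_def)
qed

text \<open>
  Since no time is skipped, a tree that is not a single leaf has a node of time 1; hence the sum in
  the recurrence starts at \<open>j = 1\<close>.
\<close>

lemma marks_nonempty:
  assumes "x \<in> timed_trees n" "n \<ge> 2"
  shows "count_list (marks x) True \<ge> 1"
proof -
  have inc: "increasing x" and w: "width x = n" and t: "times x = {1..root_time x}"
    using assms by (auto simp: timed_trees_def)
  have "x \<noteq> Lf" using w assms(2) by auto
  then have "1 \<in> times x"
    using inc t increasing_root_time_0[OF inc] by auto
  then show ?thesis
    using True_in_marks[OF inc] count_list_0_iff[of "marks x" True] by linarith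
qed

lemma width_expand:
  "length bs = width x \<Longrightarrow> width (expand x bs) = width x + count_list bs True"
proof (induction x arbitrary: bs)
  case Lf
  then show ?case by (cases bs) auto
next
  case (Br i l r)
  have "count_list bs True = count_list (take (width l) bs @ drop (width l) bs) True"
    by simp
  also have "\<dots> = count_list (take (width l) bs) True + count_list (drop (width l) bs) True"
    by (simp only: count_list_append)
  finally show ?case using Br by simp
qed

text \<open>
  Equality fails only for an unmarked single leaf, which stays at time 0. This inequality is what
  keeps the times increasing after the shift.
\<close>

lemma root_time_expand: "root_time (expand x bs) \<le> Suc (root_time x)"
  by (cases x) auto

lemma increasing_expand: "increasing x \<Longrightarrow> increasing (expand x bs)"
proof (induction x arbitrary: bs)
  case (Br i l r)
  then show ?case
    using root_time_expand[of l "take (width l) bs"] root_time_expand[of r "drop (width l) bs"]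
    by auto
qed simp

lemma collapse_expand: "increasing x \<Longrightarrow> collapse (expand x bs) = x"
  by (induction x arbitrary: bs) auto

lemma marks_expand: "increasing x \<Longrightarrow> length bs = width x \<Longrightarrow> marks (expand x bs) = bs"
proof (induction x arbitrary: bs)
  case Lf
  then show ?case by (cases bs) auto
next
  case (Br i l r)
  then show ?case by auto
qed

text \<open>
  At least one leaf must be marked: otherwise the time 1 would be missing after all times have been
  moved up by one.
\<close>

lemma expand_in_timed_trees:
  assumes x: "x \<in> timed_trees k" and bs: "bs \<in> markings k j" and j: "j \<ge> 1"
  shows "expand x bs \<in> timed_trees (k + j)"
proof -
  let ?y = "expand x bs"
  have inc: "increasing x" and w: "width x = k" and t: "times x = {1..root_time x}"
    using x by (auto simp: timed_trees_def)
  have len: "length bs = width x" and cnt: "count_list bs True = j"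
    using bs w by (auto simp: markings_def)
  have incy: "increasing ?y" using increasing_expand[OF inc] .
  have "True \<in> set bs"
    using cnt j count_list_0_iff[of bs True] by auto
  then have one: "1 \<in> times ?y"
    using True_in_marks[OF incy] marks_expand[OF inc len] by simp
  then have "1 \<le> root_time ?y"
    using times_subset[OF incy] by auto
  moreover have "root_time x = root_time ?y - 1"
    using root_time_collapse[OF incy] by (simp only: collapse_expand[OF inc])
  ultimately have rt: "root_time ?y = Suc (root_time x)"
    by linarith
  have "times ?y = insert 1 (times ?y - {1})"
    using one by (simp only: insert_Diff)
  also have "times ?y - {1} = Suc ` {1..root_time x}"
    using times_collapse[OF incy] by (simp only: collapse_expand[OF inc] t)
  also have "insert 1 (Suc ` {1..root_time x}) = {1..root_time ?y}"
    by (auto simp: rt image_Suc_atLeastAtMost)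
  finally have "times ?y = {1..root_time ?y}" .
  then show ?thesis
    using incy width_expand[OF len] cnt w by (simp add: timed_trees_def)
qed

lemma finite_markings: "finite (markings k j)"
  by (rule finite_subset[OF _ finite_lists_length_eq[of UNIV k]]) (auto simp: markings_def)

lemma card_markings: "card (markings k j) = k choose j"
proof (induction k arbitrary: j)
  case 0
  have "markings 0 j = (if j = 0 then {[]} else {})"
    by (auto simp: markings_def)
  then show ?case by (cases j) auto
next
  case (Suc k)
  show ?case
  proof (cases j)
    case 0
    have "markings (Suc k) 0 = (#) False ` markings k 0"
      by (auto simp: markings_def length_Suc_conv image_iff split: if_splits)
    then show ?thesis using Suc 0 by (simp add: card_image)
  next
    case (Suc j')
    have "markings (Suc k) (Suc j') = (#) True ` markings k j' \<union> (#) False ` markings k (Suc j')"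
      by (auto simp: markings_def length_Suc_conv image_iff split: if_splits)
    moreover have "(#) True ` markings k j' \<inter> (#) False ` markings k (Suc j') = {}"
      by auto
    ultimately show ?thesis
      using Suc Suc.IH by (simp add: card_Un_disjoint finite_markings card_image)
  qed
qed

text \<open>
  The component \<open>j\<close> is determined by the list of marks. It is kept so that the set is a disjoint
  union whose cardinality is the right-hand side of the recurrence.
\<close>

definition first_step_data :: "nat \<Rightarrow> (nat \<times> btree \<times> bool list) set" where
  "first_step_data n = (SIGMA j:{1..n div 2}. timed_trees (n - j) \<times> markings (n - j) j)"

lemma bij_betw_first_step:
  assumes "n \<ge> 2"
  shows "bij_betw (\<lambda>(j, x, bs). expand x bs) (first_step_data n) (timed_trees n)"
proof -
  have forwards: "expand x bs \<in> timed_trees n \<and>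
      (count_list (marks (expand x bs)) True, collapse (expand x bs), marks (expand x bs)) = (j, x, bs)"
    if a: "(j, x, bs) \<in> first_step_data n" for j x bs
  proof
    have j: "1 \<le> j" "j \<le> n div 2" and x: "x \<in> timed_trees (n - j)"
      and bs: "bs \<in> markings (n - j) j"
      using a by (simp_all add: first_step_data_def)
    have inc: "increasing x" and len: "length bs = width x" and cnt: "count_list bs True = j"
      using x bs by (simp_all add: timed_trees_def markings_def)
    show "(count_list (marks (expand x bs)) True, collapse (expand x bs), marks (expand x bs)) =
        (j, x, bs)"
      by (simp only: collapse_expand[OF inc] marks_expand[OF inc len] cnt)
    have "n - j + j = n" using j by simp
    then show "expand x bs \<in> timed_trees n"
      using expand_in_timed_trees[OF x bs j(1)] by simp
  qed
  have backwards: "expand (collapse x) (marks x) = x \<and>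
      (count_list (marks x) True, collapse x, marks x) \<in> first_step_data n"
    if x: "x \<in> timed_trees n" for x
  proof
    have inc: "increasing x" and w: "width x = n"
      using x by (simp_all add: timed_trees_def)
    show "expand (collapse x) (marks x) = x"
      by (rule expand_collapse[OF inc])
    define j where "j = count_list (marks x) True"
    have len: "length (marks x) = n - j" and "j \<le> length (marks x)"
      using length_marks[OF inc] width_collapse[OF inc] w count_le_length[of "marks x" True]
      unfolding j_def by linarith+
    then have "j \<in> {1..n div 2}"
      using marks_nonempty[OF x assms] unfolding j_def[symmetric] by simp
    moreover have "marks x \<in> markings (n - j) j"
      using len j_def by (simp add: markings_def)
    ultimately show "(count_list (marks x) True, collapse x, marks x) \<in> first_step_data n"
      using collapse_in_timed_trees[OF x] unfolding first_step_data_def j_def[symmetric]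
      by simp
  qed
  show ?thesis
    by (rule bij_betw_byWitness[where f' = "\<lambda>x. (count_list (marks x) True, collapse x, marks x)"])
      (use forwards backwards in fastforce)+
qed

lemma timed_trees_1: "timed_trees 1 = {Lf}"
proof -
  have "x = Lf" if "width x = 1" for x
  proof (cases x)
    case (Br i l r)
    then have "width l + width r = 1" using that by simp
    then show ?thesis using width_pos[of l] width_pos[of r] by linarith
  qed simp
  then show ?thesis by (auto simp: timed_trees_def)
qed

text \<open>
  By induction on the number of leaves: all trees summed over in the first step are smaller.
\<close>

lemma finite_timed_trees: "finite (timed_trees n)"
proof (induction n rule: less_induct)
  case (less n)
  consider "n = 0" | "n = 1" | "n \<ge> 2" by linarith
  then show ?case
  proof cases
    case 1
    then have "timed_trees n = {}"
      using width_pos by (force simp: timed_trees_def)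
    then show ?thesis by simp
  next
    case 2
    then show ?thesis by (simp add: timed_trees_1 del: One_nat_def)
  next
    case 3
    have "finite (first_step_data n)"
      unfolding first_step_data_def
      by (intro finite_SigmaI finite_cartesian_product less finite_markings) (use 3 in auto)
    then show ?thesis
      using bij_betw_finite[OF bij_betw_first_step[OF 3]] by simp
  qed
qed

lemma card_timed_trees:
  assumes "n \<ge> 2"
  shows "card (timed_trees n) =
    (\<Sum>j = 1..n div 2. ((n - j) choose (n - 2 * j)) * card (timed_trees (n - j)))"
proof -
  have "card (timed_trees n) = card (first_step_data n)"
    using bij_betw_same_card[OF bij_betw_first_step[OF assms]] by simp
  also have "\<dots> = (\<Sum>j = 1..n div 2. card (timed_trees (n - j)) * ((n - j) choose j))"
    unfolding first_step_data_def
    by (subst card_SigmaI)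
      (auto simp: finite_timed_trees finite_markings card_cartesian_product card_markings)
  also have "\<dots> = (\<Sum>j = 1..n div 2. ((n - j) choose (n - 2 * j)) * card (timed_trees (n - j)))"
  proof (rule sum.cong[OF refl])
    fix j assume "j \<in> {1..n div 2}"
    then have "j \<le> n - j" "n - j - j = n - 2 * j" by auto
    then have "(n - j) choose j = (n - j) choose (n - 2 * j)"
      using binomial_symmetric[of j "n - j"] by simp
    then show "card (timed_trees (n - j)) * ((n - j) choose j) =
        ((n - j) choose (n - 2 * j)) * card (timed_trees (n - j))"
      by simp
  qed
  finally show ?thesis .
qed

section \<open>Assembly trees of a path as ordered trees\<close>

primrec assembly :: "nat \<Rightarrow> btree \<Rightarrow> nat ltree" where
  "assembly a Lf = Node ({a}, 0) {#}"
| "assembly a (Br i l r) =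
     Node ({a..<a + width l + width r}, i) {#assembly a l, assembly (a + width l) r#}"

lemma vset_assembly [simp]: "vset (assembly a x) = {a..<a + width x}"
  by (cases x) auto

lemma time_assembly [simp]: "time (assembly a x) = root_time x"
  by (cases x) auto

text \<open>
  The children form a multiset, so the two pairs of subtrees could agree crosswise. This is
  impossible, because only the left subtree contains the vertex \<open>a\<close>.
\<close>

lemma assembly_inject: "assembly a x = assembly a y \<Longrightarrow> x = y"
proof (induction x arbitrary: a y)
  case Lf
  then show ?case by (cases y) auto
next
  case (Br i l r)
  obtain j l' r' where y: "y = Br j l' r'"
    using Br.prems by (cases y) auto
  have eq: "{#assembly a l, assembly (a + width l) r#} =
      {#assembly a l', assembly (a + width l') r'#}" and "i = j"
    using Br.prems y by auto
  have "assembly a l \<noteq> assembly (a + width l') r'"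
  proof
    assume "assembly a l = assembly (a + width l') r'"
    then have "{a..<a + width l} = {a + width l'..<a + width l' + width r'}"
      by (metis vset_assembly)
    moreover have "a \<in> {a..<a + width l}" by simp
    ultimately show False using width_pos[of l'] by simp
  qed
  then have l: "assembly a l = assembly a l'"
    and r: "assembly (a + width l) r = assembly (a + width l') r'"
    using eq by (auto simp: add_eq_conv_ex)
  have "l = l'" using Br.IH(1)[OF l] .
  moreover have "r = r'" using Br.IH(2) r calculation by simp
  ultimately show ?case using y \<open>i = j\<close> by simp
qed

lemma nodes_assembly:
  assumes "s \<in> nodes (assembly a x)" "increasing x"
  shows "\<exists>b y. s = assembly b y \<and> increasing y \<and> a \<le> b \<and> b + width y \<le> a + width x"
  using assms
proof (induction x arbitrary: a)
  case Lf
  then show ?case by (intro exI[of _ a] exI[of _ Lf]) auto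
next
  case (Br i l r)
  consider "s = assembly a (Br i l r)" | "s \<in> nodes (assembly a l)"
    | "s \<in> nodes (assembly (a + width l) r)"
    using Br.prems by auto
  then show ?case
  proof cases
    case 1
    then show ?thesis using Br.prems by (intro exI[of _ a] exI[of _ "Br i l r"]) auto
  next
    case 2
    then show ?thesis using Br.IH(1)[OF 2] Br.prems by force
  next
    case 3
    then show ?thesis using Br.IH(2)[OF 3] Br.prems by force
  qed
qed

lemma root_in_nodes [simp]: "t \<in> nodes t"
  by (cases t) auto

lemma time_nodes_assembly: "time ` nodes (assembly a x) = insert 0 (times x)"
proof (induction x arbitrary: a)
  case (Br i l r)
  then show ?case by (auto simp: image_Un)
qed simp

lemma leaf_labels_assembly:
  "leaf_labels (assembly a x) = image_mset (\<lambda>v. ({v}, 0)) (mset_set {a..<a + width x})"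
proof (induction x arbitrary: a)
  case (Br i l r)
  have "{a..<a + width l + width r} = {a..<a + width l} \<union> {a + width l..<a + width l + width r}"
    by auto
  then show ?case using Br by (simp add: mset_set_Union add.assoc)
qed simp

lemma snd_path_graph_iff:
  "{u, v} \<in> snd (path_graph n) \<longleftrightarrow>
     (v = u + 1 \<and> 1 \<le> u \<and> u \<le> n - 1) \<or> (u = v + 1 \<and> 1 \<le> v \<and> v \<le> n - 1)"
  by (auto simp: path_graph_def doubleton_eq_iff)

lemma fst_path_graph [simp]: "fst (path_graph n) = {1..n}"
  by (simp add: path_graph_def)

text \<open>
  The gluing edge joins the last vertex of the left interval to the first vertex of the right
  one.
\<close>

lemma assembly_edge_gluing:
  assumes x: "increasing x" "width x = n"
  shows "edge_gluing_rule (path_graph n) (assembly 1 x)"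
  unfolding edge_gluing_rule_def
proof (intro ballI impI)
  fix s assume s: "s \<in> nodes (assembly 1 x)" and ne: "children s \<noteq> {#}"
  obtain b y where y: "s = assembly b y" "1 \<le> b" "b + width y \<le> 1 + n"
    using nodes_assembly[OF s x(1)] x(2) by auto
  obtain i l r where lr: "y = Br i l r"
    using ne y(1) by (cases y) auto
  show "\<exists>c1 c2. children s = {#c1, c2#} \<and>
      (\<exists>v1\<in>vset c1. \<exists>v2\<in>vset c2. {v1, v2} \<in> snd (path_graph n))"
  proof (intro exI conjI bexI)
    show "children s = {#assembly b l, assembly (b + width l) r#}"
      using y lr by simp
    show "{b + width l - 1, b + width l} \<in> snd (path_graph n)"
      using y lr width_pos[of l] width_pos[of r] unfolding snd_path_graph_iff
      by (simp; linarith)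
    show "b + width l \<in> vset (assembly (b + width l) r)" by simp
    show "b + width l - 1 \<in> vset (assembly b l)"
      using width_pos[of l] by (simp; linarith)
  qed
qed

lemma assembly_time_dependent:
  assumes x: "x \<in> timed_trees n" and n: "n \<ge> 1"
  shows "time_dependent_assembly_tree (path_graph n) (assembly 1 x)"
proof (cases "n = 1")
  case True
  then have "x = Lf" using x timed_trees_1 by simp
  then show ?thesis using True by (simp add: time_dependent_assembly_tree_def)
next
  case False
  let ?t = "assembly 1 x"
  have inc: "increasing x" and w: "width x = n" and t: "times x = {1..root_time x}"
    using x by (auto simp: timed_trees_def)
  have node: "\<exists>b y. s = assembly b y \<and> increasing y \<and> 1 \<le> b \<and> b + width y \<le> 1 + n"
    if "s \<in> nodes ?t" for s
    using nodes_assembly[OF that inc] w by simp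
  have 1: "\<forall>s\<in>nodes ?t. vset s \<subseteq> {1..n}"
    using node by fastforce
  have 2: "leaf_labels ?t = image_mset (\<lambda>v. ({v}, 0)) (mset_set {1..n})"
    using w by (simp add: leaf_labels_assembly atLeastLessThanSuc_atLeastAtMost)
  have 3: "\<forall>s\<in>nodes ?t. children s \<noteq> {#} \<longrightarrow> size (children s) \<ge> 2"
    using assembly_edge_gluing[OF inc w] by (force simp: edge_gluing_rule_def)
  have 4: "\<forall>s\<in>nodes ?t. children s \<noteq> {#} \<longrightarrow>
      vset s = (\<Union>c\<in>set_mset (children s). vset c)"
  proof (intro ballI impI)
    fix s assume s: "s \<in> nodes ?t" and ne: "children s \<noteq> {#}"
    obtain b y where y: "s = assembly b y" using node[OF s] by auto
    with ne obtain i l r where "y = Br i l r" by (cases y) auto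
    then show "vset s = (\<Union>c\<in>set_mset (children s). vset c)"
      using y by auto
  qed
  (* A parent never fits inside its child, so only the pairs (child, parent) are constrained. *)
  have child: "time c < time s \<and> \<not> vset s \<subseteq> vset c"
    if s: "s \<in> nodes ?t" and c: "c \<in># children s" for s c
  proof -
    obtain b y where y: "s = assembly b y" "increasing y" using node[OF s] by auto
    with c obtain i l r where lr: "y = Br i l r" by (cases y) auto
    have "time c < time s" using y lr c by auto
    moreover have "card (vset c) < card (vset s)" using y lr c by auto
    then have "\<not> vset s \<subseteq> vset c"
      using y c lr card_mono[of "vset c" "vset s"] by auto
    ultimately show ?thesis by simp
  qed
  have 5: "\<forall>s s'. adjacent_nodes ?t s s' \<and> vset s \<subseteq> vset s' \<longrightarrow> time s < time s'"
    using child by (auto simp: adjacent_nodes_def)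
  have "x \<noteq> Lf" using w False by auto
  then have "1 \<le> root_time x"
    using increasing_root_time_0[OF inc] by simp
  moreover have "root_time x \<le> n - 1"
    using root_time_less_width[OF x] by simp
  moreover have "label ?t = ({1..n}, root_time x)"
    using w by (intro prod_eqI) (auto simp: atLeastLessThanSuc_atLeastAtMost)
  moreover have "\<exists>s\<in>nodes ?t. time s = i" if "i \<le> root_time x" for i
  proof -
    have "i \<in> time ` nodes ?t"
      using that t unfolding time_nodes_assembly by auto
    then show ?thesis by auto
  qed
  ultimately show ?thesis
    using 1 2 3 4 5 False unfolding time_dependent_assembly_tree_def by auto
qed

text \<open>
  A multiset without repetitions splits only into multisets of disjoint sets. Applied to the leaf
  labels, this shows that the two subtrees of a node sit over disjoint vertex sets.
\<close>

lemma image_mset_set_plusD: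
  assumes "finite V" "A + B = image_mset f (mset_set V)"
  obtains V1 V2 where "V = V1 \<union> V2" "V1 \<inter> V2 = {}"
    "A = image_mset f (mset_set V1)" "B = image_mset f (mset_set V2)"
proof -
  obtain M N where MN: "mset_set V = M + N" "A = image_mset f M" "B = image_mset f N"
    using image_mset_eq_plusD[OF assms(2)[symmetric]] by auto
  have cnt: "count M v + count N v = (if v \<in> V then 1 else 0)" for v
    using arg_cong[OF MN(1), of "\<lambda>X. count X v"] assms(1) by (simp add: count_mset_set')
  have le: "count M v + count N v \<le> 1" for v
    using cnt[of v] by simp
  have M: "mset_set (set_mset M) = M"
  proof (rule multiset_eqI)
    fix v
    have "count M v = 1" if "v \<in># M"
      using le[of v] that[folded count_greater_zero_iff] by linarith
    then show "count (mset_set (set_mset M)) v = count M v"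
      by (cases "v \<in># M") (simp_all add: not_in_iff count_mset_set')
  qed
  have N: "mset_set (set_mset N) = N"
  proof (rule multiset_eqI)
    fix v
    have "count N v = 1" if "v \<in># N"
      using le[of v] that[folded count_greater_zero_iff] by linarith
    then show "count (mset_set (set_mset N)) v = count N v"
      by (cases "v \<in># N") (simp_all add: not_in_iff count_mset_set')
  qed
  have "V = set_mset M \<union> set_mset N"
    using arg_cong[OF MN(1), of set_mset] assms(1) by simp
  moreover have "set_mset M \<inter> set_mset N = {}"
  proof -
    have False if "v \<in># M" "v \<in># N" for v
      using le[of v] that[folded count_greater_zero_iff] by linarith
    then show ?thesis by auto
  qed
  moreover have "A = image_mset f (mset_set (set_mset M))" "B = image_mset f (mset_set (set_mset N))"
    using MN(2,3) M N by simp_all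
  ultimately show thesis by (rule that)
qed

lemma assembly_Br_join:
  assumes "c1 = assembly a l" "c2 = assembly (a + width l) r"
    and "U = vset c1 \<union> vset c2"
  shows "Node (U, i) {#c1, c2#} = assembly a (Br i l r)"
  using assms by auto

lemma adjacent_intervals:
  fixes a b p q :: nat
  assumes "{a..<a + p} \<inter> {b..<b + q} = {}"
    and "u \<in> {a..<a + p}" "v \<in> {b..<b + q}" "v = u + 1"
  shows "b = a + p"
proof (rule ccontr)
  assume "b \<noteq> a + p"
  then have "u \<in> {b..<b + q} \<or> v \<in> {a..<a + p}"
    using assms(2-4) by auto
  then show False using assms by blast
qed

text \<open>
  By induction the two subtrees at the root live on disjoint intervals. An edge of the path between
  disjoint intervals forces them to be consecutive, so their union is an interval again; the subtree
  over the smaller vertices becomes the left one. The start \<open>a\<close> must stay arbitrary here, since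
  subtrees need not begin at the vertex 1.
\<close>

lemma ltree_is_assembly:
  assumes "finite V" "leaf_labels t = image_mset (\<lambda>v. ({v}, 0)) (mset_set V)"
    and "edge_gluing_rule (path_graph n) t"
    and "\<forall>s\<in>nodes t. children s \<noteq> {#} \<longrightarrow> vset s = (\<Union>c\<in>set_mset (children s). vset c)"
    and "\<forall>s\<in>nodes t. \<forall>c\<in>#children s. time c < time s"
  shows "\<exists>a x. t = assembly a x \<and> increasing x \<and> V = {a..<a + width x}"
  using assms
proof (induction t arbitrary: V)
  case (Node L ts)
  show ?case
  proof (cases "ts = {#}")
    case True
    then have L: "image_mset (\<lambda>v. ({v}, 0)) (mset_set V) = {#L#}"
      using Node.prems(2) by simp
    then have "size (mset_set V) = 1"
      by (metis size_image_mset size_single)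
    then obtain a where "V = {a}"
      by (auto simp: card_1_singleton_iff)
    then show ?thesis
      using L True by (intro exI[of _ a] exI[of _ Lf]) auto
  next
    case False
    obtain c1 c2 u v where c: "ts = {#c1, c2#}" "u \<in> vset c1" "v \<in> vset c2"
      and e: "{u, v} \<in> snd (path_graph n)"
      using Node.prems(3) False unfolding edge_gluing_rule_def by fastforce
    obtain U i where L: "L = (U, i)" by (cases L)
    have "leaf_labels c1 + leaf_labels c2 = image_mset (\<lambda>v. ({v}, 0)) (mset_set V)"
      using Node.prems(2) c(1) by simp
    then obtain V1 V2 where V: "V = V1 \<union> V2" "V1 \<inter> V2 = {}"
      and V1: "leaf_labels c1 = image_mset (\<lambda>v. ({v}, 0)) (mset_set V1)"
      and V2: "leaf_labels c2 = image_mset (\<lambda>v. ({v}, 0)) (mset_set V2)"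
      using image_mset_set_plusD[OF Node.prems(1)] by metis
    have fin: "finite V1" "finite V2" using V(1) Node.prems(1) by auto
    have sub: "nodes c1 \<subseteq> nodes (Node L ts)" "nodes c2 \<subseteq> nodes (Node L ts)"
      using c(1) by auto
    have "\<exists>a x. c1 = assembly a x \<and> increasing x \<and> V1 = {a..<a + width x}"
      by (rule Node.IH[OF _ fin(1) V1])
        (use c(1) sub Node.prems(3-5) in \<open>auto simp: edge_gluing_rule_def\<close>)
    then obtain a x where x: "c1 = assembly a x" "increasing x" "V1 = {a..<a + width x}"
      by auto
    have "\<exists>a x. c2 = assembly a x \<and> increasing x \<and> V2 = {a..<a + width x}"
      by (rule Node.IH[OF _ fin(2) V2])
        (use c(1) sub Node.prems(3-5) in \<open>auto simp: edge_gluing_rule_def\<close>)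
    then obtain b y where y: "c2 = assembly b y" "increasing y" "V2 = {b..<b + width y}"
      by auto
    have U: "U = vset c1 \<union> vset c2"
      using Node.prems(4) c(1) L by simp
    have time: "root_time x < i" "root_time y < i"
      using Node.prems(5) c(1) L x(1) y(1) by auto
    have disj: "{a..<a + width x} \<inter> {b..<b + width y} = {}"
      using V(2) x(3) y(3) by simp
    have uv: "u \<in> {a..<a + width x}" "v \<in> {b..<b + width y}"
      using c x(1) y(1) by auto
    from e consider "v = u + 1" | "u = v + 1"
      unfolding snd_path_graph_iff by auto
    then show ?thesis
    proof cases
      case 1
      have b: "b = a + width x" using adjacent_intervals[OF disj uv 1] .
      have "Node L ts = assembly a (Br i x y)"
        using assembly_Br_join[of c1 a x c2 y U i] x(1) y(1) b U L c(1) by simp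
      moreover have "V = {a..<a + width (Br i x y)}"
        using V(1) x(3) y(3) b by auto
      ultimately show ?thesis using x y time
        by (intro exI[of _ a] exI[of _ "Br i x y"]) auto
    next
      case 2
      have a: "a = b + width y"
        using adjacent_intervals[OF _ uv(2,1) 2] disj by blast
      have "Node L ts = assembly b (Br i y x)"
        using assembly_Br_join[of c2 b y c1 x U i] x(1) y(1) a U L c(1)
        by (simp add: Un_commute add_mset_commute)
      moreover have "V = {b..<b + width (Br i y x)}"
        using V(1) x(3) y(3) a by auto
      ultimately show ?thesis using x y time
        by (intro exI[of _ b] exI[of _ "Br i y x"]) auto
    qed
  qed
qed

lemma nodes_trans: "s \<in> nodes t \<Longrightarrow> nodes s \<subseteq> nodes t"
  by (induction t) auto

text \<open>
  The condition on adjacent nodes compares times only along inclusions of vertex sets, but a child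
  is always included in its parent, so times increase along every edge of the tree.
\<close>

lemma time_dependent_is_assembly:
  assumes t: "time_dependent_assembly_tree (path_graph n) t"
    and e: "edge_gluing_rule (path_graph n) t" and n: "n \<ge> 1"
  shows "t \<in> assembly 1 ` timed_trees n"
proof (cases "n = 1")
  case True
  then have "t = assembly 1 Lf"
    using t by (auto simp: time_dependent_assembly_tree_def)
  then show ?thesis using True timed_trees_1 by auto
next
  case False
  have leaf: "leaf_labels t = image_mset (\<lambda>v. ({v}, 0)) (mset_set {1..n})"
    and un: "\<forall>s\<in>nodes t. children s \<noteq> {#} \<longrightarrow> vset s = (\<Union>c\<in>set_mset (children s). vset c)"
    and adj: "\<And>s s'. adjacent_nodes t s s' \<Longrightarrow> vset s \<subseteq> vset s' \<Longrightarrow> time s < time s'"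
    using t False by (auto simp: time_dependent_assembly_tree_def)
  obtain m where m: "label t = ({1..n}, m)" "\<forall>i\<le>m. \<exists>s\<in>nodes t. time s = i"
    using t False by (auto simp: time_dependent_assembly_tree_def)
  have "\<forall>s\<in>nodes t. \<forall>c\<in>#children s. time c < time s"
  proof (intro ballI)
    fix s c assume s: "s \<in> nodes t" and c: "c \<in># children s"
    have "c \<in> nodes s" using c root_in_nodes[of c] by (cases s) (auto simp del: root_in_nodes)
    then have "adjacent_nodes t c s"
      using s c nodes_trans by (auto simp: adjacent_nodes_def)
    moreover have "vset c \<subseteq> vset s" using un s c by fastforce
    ultimately show "time c < time s" by (rule adj)
  qed
  then obtain a x where x: "t = assembly a x" "increasing x" "{1..n} = {a..<a + width x}"
    using ltree_is_assembly[OF _ leaf e un] by auto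
  have "a \<in> {1..n}"
    unfolding x(3) by simp
  moreover have "1 \<in> {a..<a + width x}"
    unfolding x(3)[symmetric] using n by simp
  moreover have "width x = n"
    using arg_cong[OF x(3), of card] by simp
  ultimately have a: "a = 1" "width x = n" by auto
  have "root_time x = m" using m(1) x(1) time_assembly[of a x] by simp
  have "{..m} \<subseteq> time ` nodes t"
    using m(2) by force
  then have "{1..m} \<subseteq> times x"
    unfolding x(1) time_nodes_assembly by auto
  then have "times x = {1..root_time x}"
    using times_subset[OF x(2)] \<open>root_time x = m\<close> by auto
  then show ?thesis using a x by (auto simp: timed_trees_def)
qed

lemma a_t_E_path_graph:
  assumes "n \<ge> 1"
  shows "a_t_E (path_graph n) = card (timed_trees n)"
proof -
  have "{t. time_dependent_assembly_tree (path_graph n) t \<and> edge_gluing_rule (path_graph n) t} =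
      assembly 1 ` timed_trees n"
    using time_dependent_is_assembly assembly_time_dependent assembly_edge_gluing assms
    by (auto simp: timed_trees_def)
  moreover have "inj_on (assembly 1) (timed_trees n)"
    by (rule inj_onI) (rule assembly_inject)
  ultimately show ?thesis
    by (simp add: a_t_E_def card_image)
qed

section \<open>The recurrence\<close>

theorem proposition4p10:
  shows "a_t_E (path_graph 1) = 1 \<and> a_t_E (path_graph 2) = 1 \<and>
    (\<forall>n::nat. n \<ge> 3 \<longrightarrow>
      a_t_E (path_graph n) =
        (\<Sum>j = 1..n div 2. ((n - j) choose (n - 2 * j)) * a_t_E (path_graph (n - j))))"
proof (intro conjI allI impI)
  show one: "a_t_E (path_graph 1) = 1"
    using a_t_E_path_graph[of 1] timed_trees_1 by simp
  have rec: "a_t_E (path_graph n) =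
      (\<Sum>j = 1..n div 2. ((n - j) choose (n - 2 * j)) * a_t_E (path_graph (n - j)))"
    if "n \<ge> 2" for n
  proof -
    have "a_t_E (path_graph n) = card (timed_trees n)"
      using a_t_E_path_graph that by simp
    also note card_timed_trees[OF that]
    also have "(\<Sum>j = 1..n div 2. ((n - j) choose (n - 2 * j)) * card (timed_trees (n - j))) =
        (\<Sum>j = 1..n div 2. ((n - j) choose (n - 2 * j)) * a_t_E (path_graph (n - j)))"
      using that by (intro sum.cong) (auto simp: a_t_E_path_graph)
    finally show ?thesis .
  qed
  (* The recurrence already holds for n = 2, where it has the single summand j = 1. *)
  show "a_t_E (path_graph 2) = 1"
    using rec[of 2] one by simp
  fix n :: nat assume "n \<ge> 3"
  then show "a_t_E (path_graph n) =
      (\<Sum>j = 1..n div 2. ((n - j) choose (n - 2 * j)) * a_t_E (path_graph (n - j)))"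
    by (intro rec) simp
qed

end
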